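(* Let $G=(V,E)$ be a DAG with $|V|=n$ and maximum out-degree $d_{out}$. Then there exists an $r^{(top)}$-visit $\psi$ of $G$ such that: (a) if $d_{out}=0$, then $b_{r^{(top)}}(\psi)=0$; (b) if $d_{out}=1$, then $b_{r^{(top)}}(\psi)=1$; and (c) if $d_{out}\leq D$ for some $D\geq 2$, then $b_{r^{(top)}}(\psi)\leq \frac{D-1}{\log_2 D}\log_2 n+1$.
   Context: For a vertex $v$ of a finite DAG $G=(V,E)$, $\mathrm{pred}(v)=\{u : (u,v)\in E\}$ and $\mathrm{suc}(v)=\{u : (v,u)\in E\}$; the maximum out-degree is $\max_v|\mathrm{suc}(v)|$. A visit rule $r$ for $G$ assigns to each $v\in V$ a non-empty family $r(v)$ of subsets of $\mathrm{pred}(v)$, called enablers of $v$. An $r$-sequence is a sequence $\psi$ of distinct vertices such that for every $1\le i\le|\psi|$ the set of vertices of the prefix $\psi[1..i-1]$ contains some enabler $Q\in r(\psi[i])$. An $r$-visit is an $r$-sequence containing all $n$ vertices. The $r$-boundary of an $r$-sequence $\psi$ is $B_r(\psi)=\{v\in V\setminus\psi : \exists Q\neq\emptyset,\ Q\in r(v),\ Q\subseteq\psi\}$, and $b_r(\psi)=\max_{1\le i\le|\psi|}|B_r(\psi[1..i])|$. The topological rule is $r^{(top)}(v)=\{\mathrm{pred}(v)\}$ (so $r^{(top)}$-visits are exactly the topological orderings of $G$). *)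

theory Defs
  imports Complex_Main
begin

text \<open>
  A directed graph is given by a vertex set \<open>V\<close> and an edge relation \<open>E \<subseteq> V \<times> V\<close>;
  vertex sequences are lists.
\<close>

definition dag :: "'a set \<Rightarrow> ('a \<times> 'a) set \<Rightarrow> bool" where
  "dag V E \<longleftrightarrow> finite V \<and> E \<subseteq> V \<times> V \<and> acyclic E"

definition preds :: "('a \<times> 'a) set \<Rightarrow> 'a \<Rightarrow> 'a set" where
  "preds E v = {u. (u, v) \<in> E}"

definition succs :: "('a \<times> 'a) set \<Rightarrow> 'a \<Rightarrow> 'a set" where
  "succs E v = {u. (v, u) \<in> E}"

text \<open>
  On \<^typ>\<open>nat\<close>, the supremum of a finite non-empty set is its maximum, and the supremum
  of the empty set is \<open>0\<close>; the latter only matters for the empty graph and the empty sequence.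
\<close>

definition max_outdegree :: "'a set \<Rightarrow> ('a \<times> 'a) set \<Rightarrow> nat" where
  "max_outdegree V E = (SUP v\<in>V. card (succs E v))"

definition visit_rule :: "'a set \<Rightarrow> ('a \<times> 'a) set \<Rightarrow> ('a \<Rightarrow> 'a set set) \<Rightarrow> bool" where
  "visit_rule V E r \<longleftrightarrow> (\<forall>v\<in>V. r v \<noteq> {} \<and> (\<forall>Q\<in>r v. Q \<subseteq> preds E v))"

text \<open>
  Lists are indexed from \<open>0\<close>, so \<open>take i \<psi>\<close> is the prefix strictly before the entry \<open>\<psi> ! i\<close>.
\<close>

definition r_sequence :: "'a set \<Rightarrow> ('a \<Rightarrow> 'a set set) \<Rightarrow> 'a list \<Rightarrow> bool" where
  "r_sequence V r \<psi> \<longleftrightarrow> distinct \<psi> \<and> set \<psi> \<subseteq> V \<and>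
     (\<forall>i<length \<psi>. \<exists>Q\<in>r (\<psi> ! i). Q \<subseteq> set (take i \<psi>))"

definition r_visit :: "'a set \<Rightarrow> ('a \<Rightarrow> 'a set set) \<Rightarrow> 'a list \<Rightarrow> bool" where
  "r_visit V r \<psi> \<longleftrightarrow> r_sequence V r \<psi> \<and> set \<psi> = V"

definition r_boundary :: "'a set \<Rightarrow> ('a \<Rightarrow> 'a set set) \<Rightarrow> 'a list \<Rightarrow> 'a set" where
  "r_boundary V r \<psi> = {v \<in> V - set \<psi>. \<exists>Q\<in>r v. Q \<noteq> {} \<and> Q \<subseteq> set \<psi>}"

definition boundary_complexity :: "'a set \<Rightarrow> ('a \<Rightarrow> 'a set set) \<Rightarrow> 'a list \<Rightarrow> nat" where
  "boundary_complexity V r \<psi> = (SUP i\<in>{1..length \<psi>}. card (r_boundary V r (take i \<psi>)))"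

definition top_rule :: "('a \<times> 'a) set \<Rightarrow> 'a \<Rightarrow> 'a set set" where
  "top_rule E v = {preds E v}"

lemma visit_rule_top_rule: "visit_rule V E (top_rule E)"
  by (simp add: visit_rule_def top_rule_def)

end

theory Submission
  imports Defs "HOL-Analysis.Convex"
begin

text \<open>
  Call the cone of a visitable vertex \<open>v\<close> the set of all vertices that can be visited by starting
  with \<open>v\<close> and then using only vertices that become visitable along the way. The cones of distinct
  visitable vertices are disjoint, and visiting the whole cone of \<open>v\<close> leaves the boundary as it was,
  except that \<open>v\<close> disappears. So among \<open>k\<close> pending vertices one first exhausts the smallest cone,
  which takes up at most a \<open>k\<close>-th of the union of all cones, while the other \<open>k - 1\<close> vertices wait.
  Hence \<open>g m\<close> bounds the boundary needed for cones of total size \<open>m\<close> as soon as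
  \<open>g m + (k - 1) \<le> g (k * m)\<close> for all \<open>1 \<le> k \<le> d\<close>. By concavity of the logarithm,
  \<open>g m = c * log 2 m + 1\<close> with \<open>c = (d - 1) / log 2 d\<close> will do. Sources never count towards the
  boundary, so there may be any number of them.
\<close>

section \<open>Visitable vertices and their cones\<close>

definition visitable :: "('a \<times> 'a) set \<Rightarrow> 'a set \<Rightarrow> 'a set" where
  "visitable E S = {v. v \<notin> S \<and> preds E v \<subseteq> S}"

definition top_boundary :: "('a \<times> 'a) set \<Rightarrow> 'a set \<Rightarrow> 'a set" where
  "top_boundary E S = {v \<in> visitable E S. preds E v \<noteq> {}}"

abbreviation released :: "('a \<times> 'a) set \<Rightarrow> 'a set \<Rightarrow> 'a \<Rightarrow> 'a set" where
  "released E S v \<equiv> top_boundary E (insert v S) - top_boundary E S"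

inductive_set enabled_cone :: "('a \<times> 'a) set \<Rightarrow> 'a set \<Rightarrow> 'a set \<Rightarrow> 'a set"
  for E S K where
  base: "v \<in> K \<Longrightarrow> v \<in> enabled_cone E S K"
| step: "\<lbrakk>v \<notin> S; \<not> preds E v \<subseteq> S; \<forall>u \<in> preds E v. u \<in> S \<or> u \<in> enabled_cone E S K\<rbrakk>
          \<Longrightarrow> v \<in> enabled_cone E S K"

lemma finite_top_boundary:
  assumes "finite E"
  shows "finite (top_boundary E S)"
proof (rule finite_subset)
  show "top_boundary E S \<subseteq> Range E"
    by (auto simp: top_boundary_def preds_def)
qed (rule finite_Range[OF assms])

lemma finite_succs:
  assumes "finite E"
  shows "finite (succs E v)"
proof (rule finite_subset)
  show "succs E v \<subseteq> Range E"
    by (auto simp: succs_def)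
qed (rule finite_Range[OF assms])

lemma card_released_le:
  assumes "finite E"
  shows "card (released E S v) \<le> card (succs E v)"
proof (rule card_mono[OF finite_succs[OF assms]])
  show "released E S v \<subseteq> succs E v"
    by (auto simp: top_boundary_def visitable_def succs_def preds_def)
qed

lemma finite_enabled_cone:
  assumes "finite E" "finite K"
  shows "finite (enabled_cone E S K)"
proof (rule finite_subset)
  show "enabled_cone E S K \<subseteq> K \<union> Range E"
    by (force simp: preds_def elim: enabled_cone.cases)
qed (use assms finite_Range in auto)

lemma enabled_cone_empty:
  assumes "wf E"
  shows "enabled_cone E S {} = {}"
proof -
  have "v \<notin> enabled_cone E S {}" for v
    using assms
  proof (induction v rule: wf_induct_rule)
    case (less v)
    show ?case
    proof
      assume "v \<in> enabled_cone E S {}"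
      then show False
        using less by cases (auto simp: preds_def)
    qed
  qed
  then show ?thesis by blast
qed

lemma enabled_cone_disjoint:
  assumes "K \<inter> S = {}"
  shows "enabled_cone E S K \<inter> S = {}"
  using assms by (auto elim: enabled_cone.cases)

lemma enabled_cone_subset:
  assumes "S \<subseteq> T" "T \<subseteq> S \<union> enabled_cone E S K" "L \<subseteq> enabled_cone E S K"
  shows "enabled_cone E T L \<subseteq> enabled_cone E S K"
proof
  fix v assume "v \<in> enabled_cone E T L"
  then show "v \<in> enabled_cone E S K"
  proof induction
    case (base v)
    then show ?case using assms(3) by blast
  next
    case (step v)
    then have "v \<notin> S" "\<not> preds E v \<subseteq> S"
      using assms(1) by auto
    then show ?case
      by (rule enabled_cone.step) (use step.IH assms(2) in blast)
  qed
qed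

lemma visitable_in_enabled_cone_iff:
  assumes "v \<in> visitable E S"
  shows "v \<in> enabled_cone E S K \<longleftrightarrow> v \<in> K"
proof
  assume "v \<in> enabled_cone E S K"
  then show "v \<in> K"
    using assms by cases (auto simp: visitable_def)
qed (rule enabled_cone.base)

lemma top_boundary_union_enabled_cone:
  "top_boundary E (S \<union> enabled_cone E S K) \<subseteq> top_boundary E S - K"
proof
  fix x assume x: "x \<in> top_boundary E (S \<union> enabled_cone E S K)"
  have "preds E x \<subseteq> S"
    using x enabled_cone.step[of x S E K] by (auto simp: top_boundary_def visitable_def)
  then show "x \<in> top_boundary E S - K"
    using x enabled_cone.base[of x K E S] by (auto simp: top_boundary_def visitable_def)
qed

lemma enabled_cone_singleton:
  assumes "v \<in> visitable E S"
  shows "enabled_cone E S {v} = insert v (enabled_cone E (insert v S) (released E S v))"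
    (is "?L = insert v ?R")
proof
  show "?L \<subseteq> insert v ?R"
  proof
    fix x assume "x \<in> ?L"
    then show "x \<in> insert v ?R"
    proof induction
      case (step x)
      show ?case
      proof (cases "x = v \<or> preds E x \<subseteq> insert v S")
        case True
        then show ?thesis
          using step.hyps
          by (auto simp: top_boundary_def visitable_def intro!: enabled_cone.base)
      next
        case False
        then show ?thesis
          using step by (auto intro: enabled_cone.step)
      qed
    qed simp
  qed
next
  have v: "v \<in> ?L"
    by (simp add: enabled_cone.base)
  moreover have "released E S v \<subseteq> ?L"
  proof
    fix x assume "x \<in> released E S v"
    then have "x \<notin> S" "\<not> preds E x \<subseteq> S" "preds E x \<subseteq> insert v S"
      by (auto simp: top_boundary_def visitable_def)
    then show "x \<in> ?L"
      using v by (intro enabled_cone.step) auto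
  qed
  ultimately show "insert v ?R \<subseteq> ?L"
    using enabled_cone_subset[of S "insert v S" E "{v}"] by blast
qed

lemma notin_enabled_cone_released:
  "v \<notin> enabled_cone E (insert v S) (released E S v)"
  using enabled_cone_disjoint[of "released E S v" "insert v S" E]
  by (auto simp: top_boundary_def visitable_def)

lemma card_enabled_cone_singleton:
  assumes "finite E" "v \<in> visitable E S"
  shows "card (enabled_cone E S {v}) =
    Suc (card (enabled_cone E (insert v S) (released E S v)))"
  unfolding enabled_cone_singleton[OF assms(2)]
  using finite_enabled_cone[OF assms(1) finite_Diff[OF finite_top_boundary[OF assms(1)]]]
    notin_enabled_cone_released
  by (rule card_insert_disjoint)

lemma enabled_cone_remove:
  assumes "w \<in> K"
  shows "enabled_cone E S K =
    enabled_cone E S {w} \<union> enabled_cone E (S \<union> enabled_cone E S {w}) (K - {w})"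
    (is "?L = ?C \<union> ?R")
proof
  show "?L \<subseteq> ?C \<union> ?R"
  proof
    fix x assume "x \<in> ?L"
    then show "x \<in> ?C \<union> ?R"
    proof induction
      case (base x)
      then show ?case by (cases "x = w") (auto intro: enabled_cone.base)
    next
      case (step x)
      show ?case
      proof (cases "x \<in> ?C \<or> preds E x \<subseteq> S \<union> ?C")
        case True
        then show ?thesis
          using step.hyps enabled_cone.step[of x S E "{w}"] by blast
      next
        case False
        then have "x \<in> ?R"
          by (intro enabled_cone.step) (use step in auto)
        then show ?thesis by simp
      qed
    qed
  qed
next
  have "K \<subseteq> ?L"
    by (auto intro: enabled_cone.base)
  then have "?C \<subseteq> ?L"
    using assms by (intro enabled_cone_subset) auto
  moreover from this have "?R \<subseteq> ?L"
    using \<open>K \<subseteq> ?L\<close> by (intro enabled_cone_subset) auto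
  ultimately show "?C \<union> ?R \<subseteq> ?L" by blast
qed

lemma remove_subset_visitable:
  assumes "K \<subseteq> visitable E S"
  shows "K - {w} \<subseteq> visitable E (S \<union> enabled_cone E S {w})"
proof
  fix v assume v: "v \<in> K - {w}"
  then have "v \<in> visitable E S" "v \<notin> enabled_cone E S {w}"
    using assms visitable_in_enabled_cone_iff[of v E S "{w}"] by auto
  then show "v \<in> visitable E (S \<union> enabled_cone E S {w})"
    by (auto simp: visitable_def)
qed

lemma enabled_cone_remove_disjoint:
  assumes "K \<subseteq> visitable E S"
  shows "enabled_cone E S {w} \<inter> enabled_cone E (S \<union> enabled_cone E S {w}) (K - {w}) = {}"
proof -
  have "(K - {w}) \<inter> (S \<union> enabled_cone E S {w}) = {}"
    using remove_subset_visitable[OF assms, of w] by (auto simp: visitable_def)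
  then show ?thesis
    using enabled_cone_disjoint by fastforce
qed

lemma card_enabled_cone_remove:
  assumes "finite E" "finite K" "K \<subseteq> visitable E S" "w \<in> K"
  shows "card (enabled_cone E S K) =
    card (enabled_cone E S {w}) + card (enabled_cone E (S \<union> enabled_cone E S {w}) (K - {w}))"
  unfolding enabled_cone_remove[OF assms(4), of E S]
  using assms(1,2) enabled_cone_remove_disjoint[OF assms(3)]
  by (intro card_Un_disjoint finite_enabled_cone) auto

lemma enabled_cones_disjoint:
  assumes "v \<in> visitable E S" "w \<in> visitable E S" "v \<noteq> w"
  shows "enabled_cone E S {v} \<inter> enabled_cone E S {w} = {}"
proof -
  have "x \<notin> enabled_cone E S {w}" if "x \<in> enabled_cone E S {v}" for x
    using that
  proof induction
    case (base x)
    then show ?case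
      using assms visitable_in_enabled_cone_iff[of v E S "{w}"] by auto
  next
    case (step x)
    show ?case
    proof
      assume "x \<in> enabled_cone E S {w}"
      then show False
        by cases (use step assms in \<open>auto simp: visitable_def\<close>)
    qed
  qed
  then show ?thesis by blast
qed

lemma smallest_enabled_cone:
  assumes "finite E" "finite K" "K \<subseteq> visitable E S" "K \<noteq> {}"
  obtains w where "w \<in> K" "card K * card (enabled_cone E S {w}) \<le> card (enabled_cone E S K)"
proof -
  let ?f = "\<lambda>w. card (enabled_cone E S {w})"
  obtain w where w: "w \<in> K" "\<And>u. u \<in> K \<Longrightarrow> ?f w \<le> ?f u"
    using ex_is_arg_min_if_finite[OF assms(2,4), of ?f] by (auto simp: is_arg_min_linorder)
  have "card K * ?f w \<le> (\<Sum>u\<in>K. ?f u)"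
    using sum_bounded_below[of K "?f w" ?f] w(2) by simp
  also have "\<dots> = card (\<Union>u\<in>K. enabled_cone E S {u})"
    using assms enabled_cones_disjoint[of _ E S] finite_enabled_cone[OF assms(1)]
    by (subst card_UN_disjoint) (auto, blast)
  also have "\<dots> \<le> card (enabled_cone E S K)"
    using assms
    by (intro card_mono finite_enabled_cone UN_least enabled_cone_subset)
      (auto intro: enabled_cone.base)
  finally show ?thesis using w(1) that by blast
qed

lemma enabled_cone_sources:
  assumes "E \<subseteq> V \<times> V" "wf E"
  shows "enabled_cone E {} {v \<in> V. preds E v = {}} = V"
    (is "enabled_cone E {} ?K = V")
proof (intro equalityI subsetI)
  fix v assume "v \<in> enabled_cone E {} ?K"
  then show "v \<in> V"
    using assms(1) by cases (auto simp: preds_def)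
next
  fix v assume "v \<in> V"
  with assms(2) show "v \<in> enabled_cone E {} ?K"
  proof (induction v rule: wf_induct_rule)
    case (less v)
    show ?case
    proof (cases "preds E v = {}")
      case True
      then show ?thesis
        using less.prems by (auto intro: enabled_cone.base)
    next
      case False
      then show ?thesis
        using less.IH assms(1) by (intro enabled_cone.step) (auto simp: preds_def)
    qed
  qed
qed

section \<open>Visiting the smallest cone first\<close>

fun topological_from :: "('a \<times> 'a) set \<Rightarrow> 'a set \<Rightarrow> 'a list \<Rightarrow> bool" where
  "topological_from E S [] \<longleftrightarrow> True"
| "topological_from E S (x # xs) \<longleftrightarrow> preds E x \<subseteq> S \<and> topological_from E (insert x S) xs"

lemma topological_from_append:
  "topological_from E S (xs @ ys) \<longleftrightarrow>
    topological_from E S xs \<and> topological_from E (S \<union> set xs) ys"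
  by (induction xs arbitrary: S) auto

text \<open>
  Boundary vertices outside \<open>K\<close> stay in place throughout the visit of the cone of \<open>K\<close>; they are
  not counted, so that the bound can depend on the cone alone.
\<close>

definition cone_visit :: "('a \<times> 'a) set \<Rightarrow> 'a set \<Rightarrow> 'a set \<Rightarrow> nat \<Rightarrow> 'a list \<Rightarrow> bool" where
  "cone_visit E S K b xs \<longleftrightarrow>
    distinct xs \<and> set xs = enabled_cone E S K \<and> topological_from E S xs \<and>
    (\<forall>i. card (top_boundary E (S \<union> set (take i xs)) - (top_boundary E S - K)) \<le> b)"

lemma cone_visit_mono:
  assumes "cone_visit E S K a xs" "a \<le> b"
  shows "cone_visit E S K b xs"
  using assms unfolding cone_visit_def by (meson le_trans)

lemma cone_visit_Nil:
  assumes "wf E"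
  shows "cone_visit E S {} b []"
  by (simp add: cone_visit_def enabled_cone_empty[OF assms])

lemma cone_visit_Cons:
  assumes "finite E" "v \<in> visitable E S" "1 \<le> b"
    and xs: "cone_visit E (insert v S) (released E S v) b xs"
  shows "cone_visit E S {v} b (v # xs)"
proof -
  let ?S = "insert v S"
  have "card (top_boundary E (S \<union> set (take i (v # xs))) - (top_boundary E S - {v})) \<le> b" for i
  proof (cases i)
    case 0
    have "card (top_boundary E S - (top_boundary E S - {v})) \<le> card {v}"
      by (rule card_mono) auto
    then show ?thesis
      using 0 \<open>1 \<le> b\<close> by simp
  next
    case (Suc j)
    have "top_boundary E ?S \<inter> top_boundary E S \<subseteq> top_boundary E S - {v}"
      by (auto simp: top_boundary_def visitable_def)
    then have "card (top_boundary E (S \<union> set (take i (v # xs))) - (top_boundary E S - {v}))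
        \<le> card (top_boundary E (?S \<union> set (take j xs))
            - (top_boundary E ?S - released E S v))"
      using Suc finite_top_boundary[OF assms(1)] by (intro card_mono) auto
    also have "\<dots> \<le> b"
      using xs by (simp add: cone_visit_def)
    finally show ?thesis .
  qed
  moreover have "set (v # xs) = enabled_cone E S {v}"
    using xs enabled_cone_singleton[OF assms(2)] by (simp add: cone_visit_def)
  moreover have "distinct (v # xs)"
    using xs notin_enabled_cone_released[of v E S] by (simp add: cone_visit_def)
  moreover have "topological_from E S (v # xs)"
    using xs assms(2) by (simp add: cone_visit_def visitable_def)
  ultimately show ?thesis
    by (simp add: cone_visit_def)
qed

lemma cone_visit_append:
  assumes "finite E" "finite K" "K \<subseteq> visitable E S" "w \<in> K"
    and xs: "cone_visit E S {w} a xs"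
    and ys: "cone_visit E (S \<union> enabled_cone E S {w}) (K - {w}) b ys"
    and wait: "a + card ((K - {w}) \<inter> top_boundary E S) \<le> b"
  shows "cone_visit E S K b (xs @ ys)"
proof -
  let ?S = "S \<union> enabled_cone E S {w}" and ?W = "(K - {w}) \<inter> top_boundary E S"
  have "card (top_boundary E (S \<union> set (take i (xs @ ys))) - (top_boundary E S - K)) \<le> b" for i
  proof (cases "i \<le> length xs")
    case True
    let ?R = "top_boundary E (S \<union> set (take i xs))"
    have "card (?R - (top_boundary E S - K)) \<le> card ((?R - (top_boundary E S - {w})) \<union> ?W)"
      using assms(2) finite_top_boundary[OF assms(1)] by (intro card_mono) auto
    also have "\<dots> \<le> card (?R - (top_boundary E S - {w})) + card ?W"
      by (rule card_Un_le)
    also have "\<dots> \<le> b"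
      using xs wait unfolding cone_visit_def by (meson add_right_mono le_trans)
    finally show ?thesis
      using True by simp
  next
    case False
    let ?R = "top_boundary E (?S \<union> set (take (i - length xs) ys))"
    have "top_boundary E ?S - (K - {w}) \<subseteq> top_boundary E S - K"
      using top_boundary_union_enabled_cone[of E S "{w}"] by auto
    then have "card (?R - (top_boundary E S - K)) \<le> card (?R - (top_boundary E ?S - (K - {w})))"
      using finite_top_boundary[OF assms(1)] by (intro card_mono) auto
    also have "\<dots> \<le> b"
      using ys by (simp add: cone_visit_def)
    finally show ?thesis
      using False xs by (simp add: cone_visit_def Un_assoc)
  qed
  then show ?thesis
    using xs ys enabled_cone_remove[OF assms(4), of E S] enabled_cone_remove_disjoint[OF assms(3)]
    by (simp add: cone_visit_def topological_from_append)
qed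

definition waiting_bound :: "nat \<Rightarrow> (nat \<Rightarrow> nat) \<Rightarrow> bool" where
  "waiting_bound d g \<longleftrightarrow> mono g \<and> 1 \<le> g 0 \<and>
    (\<forall>k m. 1 \<le> k \<longrightarrow> k \<le> d \<longrightarrow> 0 < m \<longrightarrow> g m + (k - 1) \<le> g (k * m))"

lemma waiting_bound_mono:
  assumes "waiting_bound d g" "m \<le> n"
  shows "g m \<le> g n"
  using assms by (auto simp: waiting_bound_def dest: monoD)

lemma waiting_bound_add_card_le:
  assumes g: "waiting_bound d g" and "finite K" "w \<in> K" "W \<subseteq> K - {w}" "W \<noteq> {} \<Longrightarrow> card K \<le> d"
    and "0 < m" "card K * m \<le> n"
  shows "g m + card W \<le> g n"
proof -
  have K: "1 \<le> card K"
    using assms(2,3) by (auto simp: Suc_le_eq card_gt_0_iff)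
  show ?thesis
  proof (cases "W = {}")
    case True
    have "m \<le> n"
      using K assms(7) mult_le_mono1[of 1 "card K" m] by linarith
    then show ?thesis
      using True waiting_bound_mono[OF g] by simp
  next
    case False
    have "card W \<le> card (K - {w})"
      using assms(2,4) by (intro card_mono) auto
    then have "g m + card W \<le> g m + (card K - 1)"
      using assms(3) by simp
    also have "\<dots> \<le> g (card K * m)"
      using g K assms(5)[OF False] assms(6) unfolding waiting_bound_def by blast
    also have "\<dots> \<le> g n"
      using g assms(7) by (rule waiting_bound_mono)
    finally show ?thesis .
  qed
qed

lemma ex_cone_visit_remove:
  assumes "finite E" and g: "waiting_bound d g"
    and K: "finite K" "K \<subseteq> visitable E S" "K \<inter> top_boundary E S \<noteq> {} \<Longrightarrow> card K \<le> d"
    and w: "w \<in> K" "card K * card (enabled_cone E S {w}) \<le> card (enabled_cone E S K)"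
    and xs: "cone_visit E (insert w S) (released E S w)
      (g (card (enabled_cone E (insert w S) (released E S w)))) xs"
    and ys: "cone_visit E (S \<union> enabled_cone E S {w}) (K - {w})
      (g (card (enabled_cone E (S \<union> enabled_cone E S {w}) (K - {w})))) ys"
  shows "\<exists>zs. cone_visit E S K (g (card (enabled_cone E S K))) zs"
proof -
  let ?C = "enabled_cone E S {w}" and ?m = "card (enabled_cone E S K)"
  have w_visitable: "w \<in> visitable E S"
    using w K(2) by auto
  have card_C: "card ?C = Suc (card (enabled_cone E (insert w S) (released E S w)))"
    using assms(1) w_visitable by (rule card_enabled_cone_singleton)
  have "cone_visit E (insert w S) (released E S w) (g (card ?C)) xs"
    using card_C by (intro cone_visit_mono[OF xs] waiting_bound_mono[OF g]) simp
  moreover have "1 \<le> g (card ?C)"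
    using g waiting_bound_mono[OF g, of 0 "card ?C"] by (simp add: waiting_bound_def)
  ultimately have visit_C: "cone_visit E S {w} (g (card ?C)) (w # xs)"
    using assms(1) w_visitable by (intro cone_visit_Cons)
  have "cone_visit E (S \<union> ?C) (K - {w}) (g ?m) ys"
    using card_enabled_cone_remove[OF assms(1) K(1,2) w(1)]
    by (intro cone_visit_mono[OF ys] waiting_bound_mono[OF g]) simp
  moreover have "g (card ?C) + card ((K - {w}) \<inter> top_boundary E S) \<le> g ?m"
    using card_C K(3) by (intro waiting_bound_add_card_le[OF g K(1) w(1) _ _ _ w(2)]) auto
  ultimately show ?thesis
    using cone_visit_append[OF assms(1) K(1,2) w(1) visit_C] by blast
qed

lemma ex_cone_visit:
  assumes E: "finite E" "wf E" "\<And>v. card (succs E v) \<le> d"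
    and g: "waiting_bound d g"
    and "finite K" "K \<subseteq> visitable E S" "K \<inter> top_boundary E S \<noteq> {} \<Longrightarrow> card K \<le> d"
  shows "\<exists>xs. cone_visit E S K (g (card (enabled_cone E S K))) xs"
  using assms(5-7)
proof (induction "card (enabled_cone E S K)" arbitrary: S K rule: less_induct)
  case less
  show ?case
  proof (cases "K = {}")
    case True
    then show ?thesis
      using cone_visit_Nil[OF E(2)] by blast
  next
    case False
    then obtain w where w: "w \<in> K"
      and small: "card K * card (enabled_cone E S {w}) \<le> card (enabled_cone E S K)"
      using smallest_enabled_cone[OF E(1) less.prems(1,2)] by blast
    let ?C = "enabled_cone E S {w}"
    have card_C: "card ?C = Suc (card (enabled_cone E (insert w S) (released E S w)))"
      using w less.prems(2) by (intro card_enabled_cone_singleton[OF E(1)]) auto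
    have card_cone: "card (enabled_cone E S K) =
        card ?C + card (enabled_cone E (S \<union> ?C) (K - {w}))"
      using E(1) less.prems(1,2) w by (rule card_enabled_cone_remove)
    have "released E S w \<subseteq> visitable E (insert w S)"
      by (auto simp: top_boundary_def)
    moreover have "card (released E S w) \<le> d"
      using card_released_le[OF E(1)] E(3) by (rule le_trans)
    ultimately obtain xs where xs: "cone_visit E (insert w S) (released E S w)
        (g (card (enabled_cone E (insert w S) (released E S w)))) xs"
      using less.hyps[of "insert w S" "released E S w"] card_C card_cone
        finite_top_boundary[OF E(1)] by auto
    have "card (K - {w}) \<le> d" if "(K - {w}) \<inter> top_boundary E (S \<union> ?C) \<noteq> {}"
    proof -
      have "K \<inter> top_boundary E S \<noteq> {}"
        using that top_boundary_union_enabled_cone[of E S "{w}"] by blast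
      then show ?thesis
        using less.prems(3) card_Diff1_le[of K w] by linarith
    qed
    then obtain ys where "cone_visit E (S \<union> ?C) (K - {w})
        (g (card (enabled_cone E (S \<union> ?C) (K - {w})))) ys"
      using less.hyps[of "S \<union> ?C" "K - {w}"] card_C card_cone less.prems(1)
        remove_subset_visitable[OF less.prems(2)] by auto
    then show ?thesis
      using ex_cone_visit_remove[OF E(1) g less.prems w small xs] by blast
  qed
qed

section \<open>Boundary complexity\<close>

lemma nat_SUP_le_iff:
  fixes f :: "'b \<Rightarrow> nat"
  assumes "finite A"
  shows "(SUP x\<in>A. f x) \<le> b \<longleftrightarrow> (\<forall>x\<in>A. f x \<le> b)"
  using assms by (cases "A = {}") (simp_all add: cSUP_le_iff)

lemma r_boundary_top_rule:
  assumes "E \<subseteq> V \<times> V"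
  shows "r_boundary V (top_rule E) xs = top_boundary E (set xs)"
  using assms by (auto simp: r_boundary_def top_rule_def top_boundary_def visitable_def preds_def)

lemma boundary_complexity_top_rule_le_iff:
  assumes "E \<subseteq> V \<times> V"
  shows "boundary_complexity V (top_rule E) \<psi> \<le> b \<longleftrightarrow>
    (\<forall>i\<in>{1..length \<psi>}. card (top_boundary E (set (take i \<psi>))) \<le> b)"
  by (simp add: boundary_complexity_def nat_SUP_le_iff r_boundary_top_rule[OF assms])

lemma topological_from_nth:
  assumes "topological_from E S xs" "i < length xs"
  shows "preds E (xs ! i) \<subseteq> S \<union> set (take i xs)"
proof -
  have "topological_from E (S \<union> set (take i xs)) (xs ! i # drop (Suc i) xs)"
    using assms by (metis id_take_nth_drop topological_from_append)
  then show ?thesis by simp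
qed

lemma r_visit_top_ruleI:
  assumes "distinct \<psi>" "set \<psi> = V" "topological_from E {} \<psi>"
  shows "r_visit V (top_rule E) \<psi>"
  using assms topological_from_nth[OF assms(3)]
  by (auto simp: r_visit_def r_sequence_def top_rule_def)

lemma dag_finite_wf:
  assumes "dag V E"
  shows "finite E" "wf E"
proof -
  show "finite E"
    using assms by (auto simp: dag_def intro: finite_subset)
  then show "wf E"
    using assms by (simp add: dag_def finite_acyclic_wf)
qed

lemma ex_top_visit:
  assumes "dag V E" "\<And>v. card (succs E v) \<le> d" "waiting_bound d g"
  obtains \<psi> where "r_visit V (top_rule E) \<psi>" "boundary_complexity V (top_rule E) \<psi> \<le> g (card V)"
proof -
  let ?K = "{v \<in> V. preds E v = {}}"
  have V: "finite V" "E \<subseteq> V \<times> V"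
    using assms(1) by (auto simp: dag_def)
  have no_boundary: "top_boundary E {} = {}"
    by (auto simp: top_boundary_def visitable_def)
  have "\<exists>xs. cone_visit E {} ?K (g (card (enabled_cone E {} ?K))) xs"
    using V no_boundary
    by (intro ex_cone_visit[OF dag_finite_wf[OF assms(1)] assms(2,3)]) (auto simp: visitable_def)
  then obtain \<psi> where "cone_visit E {} ?K (g (card V)) \<psi>"
    using enabled_cone_sources[OF V(2) dag_finite_wf(2)[OF assms(1)]] by auto
  then show ?thesis
    using that[of \<psi>] V(2) enabled_cone_sources[OF V(2) dag_finite_wf(2)[OF assms(1)]] no_boundary
    by (simp add: cone_visit_def r_visit_top_ruleI boundary_complexity_top_rule_le_iff)
qed

lemma card_succs_le_max_outdegree:
  assumes "dag V E"
  shows "card (succs E v) \<le> max_outdegree V E"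
proof (cases "v \<in> V")
  case True
  then show ?thesis
    using assms by (auto simp: max_outdegree_def dag_def intro: cSUP_upper)
next
  case False
  then have "succs E v = {}"
    using assms by (auto simp: dag_def succs_def)
  then show ?thesis by simp
qed

lemma max_outdegree_eq_0_iff:
  assumes "dag V E"
  shows "max_outdegree V E = 0 \<longleftrightarrow> E = {}"
proof
  assume "max_outdegree V E = 0"
  then have "succs E v = {}" for v
    using card_succs_le_max_outdegree[OF assms, of v] finite_succs[OF dag_finite_wf(1)[OF assms]]
    by simp
  then show "E = {}"
    by (auto simp: succs_def)
next
  assume "E = {}"
  then have "max_outdegree V E \<le> 0"
    using assms unfolding max_outdegree_def
    by (subst nat_SUP_le_iff) (auto simp: dag_def succs_def)
  then show "max_outdegree V E = 0" by simp
qed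

lemma r_visit_top_rule_nth_in_top_boundary:
  assumes "r_visit V (top_rule E) \<psi>" "k < length \<psi>" "preds E (\<psi> ! k) \<noteq> {}"
  shows "\<psi> ! k \<in> top_boundary E (set (take k \<psi>))"
proof -
  have "distinct \<psi>" "preds E (\<psi> ! k) \<subseteq> set (take k \<psi>)"
    using assms by (auto simp: r_visit_def r_sequence_def top_rule_def)
  moreover from this have "\<psi> ! k \<notin> set (take k \<psi>)"
    using assms(2) by (auto simp: in_set_conv_nth nth_eq_iff_index_eq)
  ultimately show ?thesis
    using assms(3) by (simp add: top_boundary_def visitable_def)
qed

lemma boundary_complexity_top_rule_eq_0_iff:
  assumes "dag V E" "r_visit V (top_rule E) \<psi>"
  shows "boundary_complexity V (top_rule E) \<psi> = 0 \<longleftrightarrow> E = {}"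
proof -
  have E: "E \<subseteq> V \<times> V"
    using assms(1) by (simp add: dag_def)
  have zero_iff: "boundary_complexity V (top_rule E) \<psi> = 0 \<longleftrightarrow>
      (\<forall>i\<in>{1..length \<psi>}. top_boundary E (set (take i \<psi>)) = {})"
    using boundary_complexity_top_rule_le_iff[OF E, of \<psi> 0]
      finite_top_boundary[OF dag_finite_wf(1)[OF assms(1)]] by simp
  show ?thesis
  proof
    assume "E = {}"
    then show "boundary_complexity V (top_rule E) \<psi> = 0"
      unfolding zero_iff by (simp add: top_boundary_def preds_def)
  next
    assume zero: "boundary_complexity V (top_rule E) \<psi> = 0"
    show "E = {}"
    proof (rule ccontr)
      assume "E \<noteq> {}"
      then obtain u v where uv: "(u, v) \<in> E" by auto
      then have "v \<in> set \<psi>"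
        using E assms(2) by (auto simp: r_visit_def)
      then obtain k where k: "k < length \<psi>" "\<psi> ! k = v"
        by (auto simp: in_set_conv_nth)
      then have v: "v \<in> top_boundary E (set (take k \<psi>))"
        using r_visit_top_rule_nth_in_top_boundary[OF assms(2), of k] uv by (auto simp: preds_def)
      then have "k \<noteq> 0"
        by (auto simp: top_boundary_def visitable_def)
      then show False
        using zero k v unfolding zero_iff by force
    qed
  qed
qed

section \<open>The logarithmic bound\<close>

text \<open>
  The reciprocal slope of the chord of \<open>log 2\<close> between \<open>1\<close> and \<open>d\<close>. For \<open>d \<le> 1\<close> the denominator
  is \<open>0\<close>, and division by \<open>0\<close> yields the value \<open>0\<close> that is needed there.
\<close>

definition inv_log_slope :: "nat \<Rightarrow> real" where
  "inv_log_slope d = (real d - 1) / log 2 (real d)"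

lemma inv_log_slope_eq_0:
  assumes "d \<le> 1"
  shows "inv_log_slope d = 0"
  using assms by (cases d) (auto simp: inv_log_slope_def log_def)

lemma inv_log_slope_nonneg: "0 \<le> inv_log_slope d"
proof (cases "d \<le> 1")
  case False
  then show ?thesis by (simp add: inv_log_slope_def)
qed (simp add: inv_log_slope_eq_0)

lemma minus_one_le_inv_log_slope:
  assumes "1 \<le> j" "j \<le> d"
  shows "real j - 1 \<le> inv_log_slope d * log 2 (real j)"
proof (cases "d \<le> 1")
  case True
  then show ?thesis
    using assms by (simp add: inv_log_slope_eq_0)
next
  case False
  have log_d: "log 2 (real d) \<noteq> 0"
    using False zero_less_log_cancel_iff[of 2 "real d"] by linarith
  define t where "t = (real j - 1) / (real d - 1)"
  have t: "0 \<le> t" "t \<le> 1"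
    using assms False by (auto simp: t_def)
  have "t * (real d - 1) = real j - 1"
    using False by (simp add: t_def)
  then have j: "(1 - t) * 1 + t * real d = real j"
    by (simp add: algebra_simps)
  have "convex_on {0<..} (\<lambda>x. - log 2 x)"
    by (rule minus_log_convex) simp
  then have "t * log 2 (real d) \<le> log 2 (real j)"
    using convex_onD[of "{0<..}" "\<lambda>x. - log 2 x" t 1 "real d"] t j False by simp
  then have "t * log 2 (real d) * inv_log_slope d \<le> log 2 (real j) * inv_log_slope d"
    using inv_log_slope_nonneg by (rule mult_right_mono)
  also have "t * log 2 (real d) * inv_log_slope d = real j - 1"
    using False log_d by (simp add: t_def inv_log_slope_def)
  finally show ?thesis
    by (simp add: mult.commute)
qed

lemma inv_log_slope_mono:
  assumes "d \<le> e"
  shows "inv_log_slope d \<le> inv_log_slope e"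
proof (cases "d \<le> 1")
  case True
  then show ?thesis
    by (simp add: inv_log_slope_eq_0 inv_log_slope_nonneg)
next
  case False
  then show ?thesis
    using minus_one_le_inv_log_slope[of d e] assms
    by (simp add: inv_log_slope_def[of d] pos_divide_le_eq)
qed

lemma log_of_nat_mono:
  assumes "1 < b" "m \<le> n"
  shows "log b (real m) \<le> log b (real n)"
  using assms by (cases "m = 0"; cases "n = 0") (auto simp: log_def divide_right_mono)

lemma log_of_nat_nonneg:
  assumes "1 < b"
  shows "0 \<le> log b (real n)"
  using log_of_nat_mono[OF assms, of 0 n] by (simp add: log_def)

lemma waiting_bound_log:
  assumes "0 \<le> s" "\<And>k. 1 \<le> k \<Longrightarrow> k \<le> d \<Longrightarrow> real k - 1 \<le> s * log 2 (real k)"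
  shows "waiting_bound d (\<lambda>m. nat \<lfloor>s * log 2 (real m) + 1\<rfloor>)"
  unfolding waiting_bound_def
proof (intro conjI allI impI)
  show "mono (\<lambda>m. nat \<lfloor>s * log 2 (real m) + 1\<rfloor>)"
    using assms(1)
    by (intro monoI nat_mono floor_mono add_right_mono mult_left_mono log_of_nat_mono) auto
  show "1 \<le> nat \<lfloor>s * log 2 (real 0) + 1\<rfloor>"
    by (simp add: log_def)
next
  fix k m :: nat assume k: "1 \<le> k" "k \<le> d" and m: "0 < m"
  have "0 \<le> s * log 2 (real m)"
    using assms(1) m by simp
  then have "nat \<lfloor>s * log 2 (real m) + 1\<rfloor> + (k - 1) = nat \<lfloor>s * log 2 (real m) + real k\<rfloor>"
    using k(1) by (simp add: nat_add_distrib)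
  also have "\<dots> \<le> nat \<lfloor>s * log 2 (real (k * m)) + 1\<rfloor>"
  proof (intro nat_mono floor_mono)
    have "s * log 2 (real (k * m)) = s * log 2 (real k) + s * log 2 (real m)"
      using k m by (simp add: log_mult distrib_left)
    then show "s * log 2 (real m) + real k \<le> s * log 2 (real (k * m)) + 1"
      using assms(2)[OF k] by linarith
  qed
  finally show "nat \<lfloor>s * log 2 (real m) + 1\<rfloor> + (k - 1) \<le> nat \<lfloor>s * log 2 (real (k * m)) + 1\<rfloor>" .
qed

lemma ex_top_visit_log:
  assumes "dag V E"
  obtains \<psi> where "r_visit V (top_rule E) \<psi>"
    and "real (boundary_complexity V (top_rule E) \<psi>)
      \<le> inv_log_slope (max_outdegree V E) * log 2 (real (card V)) + 1"
proof -
  let ?b = "inv_log_slope (max_outdegree V E) * log 2 (real (card V)) + 1"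
  obtain \<psi> where visit: "r_visit V (top_rule E) \<psi>"
    and "boundary_complexity V (top_rule E) \<psi> \<le> nat \<lfloor>?b\<rfloor>"
    using ex_top_visit[OF assms card_succs_le_max_outdegree[OF assms]
        waiting_bound_log[OF inv_log_slope_nonneg minus_one_le_inv_log_slope]] by blast
  then have "real (boundary_complexity V (top_rule E) \<psi>) \<le> real (nat \<lfloor>?b\<rfloor>)"
    by simp
  also have "\<dots> \<le> ?b"
    by (intro of_nat_floor add_nonneg_nonneg mult_nonneg_nonneg inv_log_slope_nonneg
        log_of_nat_nonneg) simp_all
  finally show ?thesis
    using visit that by blast
qed

theorem theorem16:
  fixes V :: "'a set" and E :: "('a \<times> 'a) set" and n :: nat
  assumes "dag V E" and "card V = n"
  shows "\<exists>\<psi>. r_visit V (top_rule E) \<psi> \<and>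
    (max_outdegree V E = 0 \<longrightarrow> boundary_complexity V (top_rule E) \<psi> = 0) \<and>
    (max_outdegree V E = 1 \<longrightarrow> boundary_complexity V (top_rule E) \<psi> = 1) \<and>
    (\<forall>D::nat. 2 \<le> D \<and> max_outdegree V E \<le> D \<longrightarrow>
       real (boundary_complexity V (top_rule E) \<psi>)
         \<le> (real D - 1) / log 2 (real D) * log 2 (real n) + 1)"
proof -
  let ?d = "max_outdegree V E" and ?b = "boundary_complexity V (top_rule E)"
  obtain \<psi> where visit: "r_visit V (top_rule E) \<psi>"
    and bound: "real (?b \<psi>) \<le> inv_log_slope ?d * log 2 (real n) + 1"
    using ex_top_visit_log[OF assms(1)] unfolding assms(2) .
  have zero_iff: "?b \<psi> = 0 \<longleftrightarrow> ?d = 0"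
    using max_outdegree_eq_0_iff boundary_complexity_top_rule_eq_0_iff visit assms(1) by metis
  have "?b \<psi> = 1" if "?d = 1"
    using that bound zero_iff by (simp add: inv_log_slope_eq_0)
  moreover have "real (?b \<psi>) \<le> inv_log_slope D * log 2 (real n) + 1" if "?d \<le> D" for D
    using bound mult_right_mono[OF inv_log_slope_mono[OF that] log_of_nat_nonneg[of 2 n]]
    by linarith
  ultimately show ?thesis
    using visit zero_iff by (intro exI[of _ \<psi>]) (simp add: inv_log_slope_def)
qed

end
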